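(* For each fixed integer $k\geq 3$, there exists $R\in\mathbb{N}$ such that for all integers $r\geq R$ and all integers $b$ with $1\leq b\leq\binom{r+k}{k}$, an $(r,k,b)^*$-matrix exists, and hence an $(r+k,r,b)$-matrix exists.
   Context: All matrices have entries in $\mathbb{C}$. $\mathbb{N}$ denotes the positive integers. A submatrix of a matrix $M$ is obtained by selecting a subset of the rows and a subset of the columns and keeping the entries at their intersections in the same relative positions; it is a square submatrix if the two subsets have the same cardinality. Submatrices are counted by the choice of row and column subsets. The empty submatrix (no rows, no columns) counts as a square submatrix and is defined to be invertible. An $(r,k,b)^*$-matrix is an $r\times k$ matrix with exactly $b$ invertible square submatrices (of all sizes, including the empty one). An $(n,r,b)$-matrix is an $r\times n$ matrix with exactly $b$ invertible $r\times r$ submatrices (i.e. exactly $b$ of the $\binom{n}{r}$ choices of $r$ columns give an invertible matrix). *)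

theory Defs
  imports Complex_Main "Jordan_Normal_Form.DL_Submatrix"
begin

(* Rows and columns are numbered from 0, and submatrix M I J keeps the rows in I and the
   columns in J, in increasing order. Submatrices are counted as pairs (I, J) of index sets, not
   as matrices, so equal submatrices in different positions are counted separately. *)

definition inv_square_submatrices :: "complex mat \<Rightarrow> (nat set \<times> nat set) set" where
  "inv_square_submatrices M =
     {(I, J). I \<subseteq> {..<dim_row M} \<and> J \<subseteq> {..<dim_col M} \<and> card I = card J \<and>
              invertible_mat (submatrix M I J)}"

definition rkb_star_matrix :: "nat \<Rightarrow> nat \<Rightarrow> nat \<Rightarrow> complex mat \<Rightarrow> bool" where
  "rkb_star_matrix r k b M \<longleftrightarrow>
     M \<in> carrier_mat r k \<and> card (inv_square_submatrices M) = b"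

definition nrb_matrix :: "nat \<Rightarrow> nat \<Rightarrow> nat \<Rightarrow> complex mat \<Rightarrow> bool" where
  "nrb_matrix n r b M \<longleftrightarrow>
     M \<in> carrier_mat r n \<and>
     card {J. J \<subseteq> {..<n} \<and> card J = r \<and> invertible_mat (submatrix M {..<r} J)} = b"

(* The 0 x 0 submatrix is invertible for the library's notion of invertibility, so it is
   counted without a special clause. *)
lemma empty_in_inv_square_submatrices: "({}, {}) \<in> inv_square_submatrices M"
proof -
  have "invertible_mat (submatrix M {} {})"
    unfolding invertible_mat_def inverts_mat_def square_mat.simps
    by (intro conjI exI[of _ "1\<^sub>m 0"]) (auto simp: dim_submatrix)
  then show ?thesis by (simp add: inv_square_submatrices_def)
qed

end

theory Submission
  imports Defs "Jordan_Normal_Form.Determinant"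
begin

text \<open>Colour the \<open>r\<close> rows and choose every row as a generic vector of a hyperplane in \<open>k\<close>-space that
  depends only on its colour. Then a square submatrix is singular exactly when it consists of all \<open>k\<close>
  columns and of \<open>k\<close> rows of one colour (\<open>generic_coloured_rows\<close>). There are \<open>(r + k) choose k\<close>
  square submatrices in total, so with colour classes of sizes \<open>a\<^sub>1, a\<^sub>2, \<dots>\<close> the number of invertible
  ones is \<open>(r + k) choose k\<close> minus the sum of the \<open>a\<^sub>i choose k\<close>.

  It remains to write deficits as sums of binomial coefficients \<open>a\<^sub>i choose k\<close> with few points in
  total. A greedy choice represents every \<open>h < a choose k\<close> with \<open>2 * a + D\<close> points, where \<open>D\<close>
  depends only on \<open>k\<close> (\<open>mono_count_attained_below_choose\<close>). As \<open>(r div 4) choose k\<close> has order \<open>r ^ k\<close>, for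
  large \<open>r\<close> this covers all deficits below \<open>(r + k) choose (k - 1)\<close>, which gives all \<open>b\<close> from
  \<open>(r + k) choose k\<close> down to \<open>((r - 1) + k) choose k\<close>, the total for one row less. Zero rows do not change the number of
  invertible submatrices, so these ranges for successive numbers of rows join and cover every
  \<open>b\<close> above a constant. The finitely many smaller values of \<open>b\<close> come from matrices with one nonzero
  column (\<open>ex_card_regular_pairs\<close>).

  Finally, the square submatrices of an \<open>r \<times> k\<close> matrix \<open>m\<close> correspond to the \<open>r\<close>-subsets of the
  columns of \<open>(1 | m)\<close>, and invertibility is preserved (\<open>trivial_kernel_dual_columns\<close>). This gives
  both the total \<open>(r + k) choose k\<close> and the second half of the theorem.\<close>

section \<open>Invertibility as injectivity on index sets\<close>

text \<open>The index sets of a submatrix are kept as sets: trivial kernel of the block with rows \<open>I\<close> and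
  columns \<open>J\<close> is a statement about functions on \<open>J\<close>, so rows can be added and columns dropped
  without renumbering the remaining ones.\<close>

definition trivial_kernel :: "(nat \<Rightarrow> nat \<Rightarrow> 'a::field) \<Rightarrow> nat set \<Rightarrow> nat set \<Rightarrow> bool" where
  "trivial_kernel m I J \<longleftrightarrow>
     (\<forall>x. (\<forall>i\<in>I. (\<Sum>j\<in>J. m i j * x j) = 0) \<longrightarrow> (\<forall>j\<in>J. x j = 0))"

lemma trivial_kernel_cong:
  assumes "\<And>i j. i \<in> I \<Longrightarrow> j \<in> J \<Longrightarrow> m i j = m' i j"
  shows "trivial_kernel m I J \<longleftrightarrow> trivial_kernel m' I J"
  using assms by (simp add: trivial_kernel_def cong: sum.cong)

lemma invertible_matE:
  assumes "A \<in> carrier_mat n n" and "invertible_mat A"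
  obtains B where "B \<in> carrier_mat n n" "A * B = 1\<^sub>m n" "B * A = 1\<^sub>m n"
proof -
  obtain B where AB: "A * B = 1\<^sub>m (dim_row A)" and BA: "B * A = 1\<^sub>m (dim_row B)"
    using assms(2) unfolding invertible_mat_def inverts_mat_def by blast
  have "dim_row B = n" by (metis BA assms(1) carrier_matD(2) index_mult_mat(3) index_one_mat(3))
  moreover have "dim_col B = n"
    by (metis AB assms(1) carrier_matD(1) index_mult_mat(3) index_one_mat(3))
  ultimately show thesis using that[of B] AB BA assms(1) by auto
qed

lemma invertible_mat_iff_trivial_kernel:
  fixes m :: "nat \<Rightarrow> nat \<Rightarrow> 'a::field"
  assumes e: "bij_betw e {..<n} I" and f: "bij_betw f {..<n} J"
  shows "invertible_mat (mat n n (\<lambda>(a, b). m (e a) (f b))) \<longleftrightarrow> trivial_kernel m I J"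
    (is "invertible_mat ?A \<longleftrightarrow> _")
proof -
  have A: "?A \<in> carrier_mat n n" by simp
  have mult: "(?A *\<^sub>v v) $ a = (\<Sum>j\<in>J. m (e a) j * x j)"
    if "a < n" "v \<in> carrier_vec n" "\<And>b. b < n \<Longrightarrow> v $ b = x (f b)" for a v x
  proof -
    have "(?A *\<^sub>v v) $ a = (\<Sum>b<n. m (e a) (f b) * x (f b))"
      using that by (auto simp: scalar_prod_def atLeast0LessThan intro!: sum.cong)
    also have "\<dots> = (\<Sum>j\<in>J. m (e a) j * x j)"
      using sum.reindex_bij_betw[OF f, of "\<lambda>j. m (e a) j * x j"] by simp
    finally show ?thesis .
  qed
  have I: "I = e ` {..<n}" and J: "J = f ` {..<n}"
    using e f by (auto simp: bij_betw_def)
  show ?thesis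
  proof
    assume "invertible_mat ?A"
    then obtain B where B: "B \<in> carrier_mat n n" "B * ?A = 1\<^sub>m n"
      using invertible_matE[OF A] by blast
    have "x j = 0" if ker: "\<forall>i\<in>I. (\<Sum>j\<in>J. m i j * x j) = 0" and "j \<in> J" for x j
    proof -
      define v where "v = vec n (x \<circ> f)"
      have v: "v \<in> carrier_vec n" by (simp add: v_def)
      have "(?A *\<^sub>v v) $ a = 0" if "a < n" for a
        using mult[OF that v, of x] ker that I by (simp add: v_def)
      then have "?A *\<^sub>v v = 0\<^sub>v n" by (intro eq_vecI) auto
      then have "(B * ?A) *\<^sub>v v = 0\<^sub>v n"
        using assoc_mult_mat_vec[OF B(1) A v] B(1) by auto
      then have "v = 0\<^sub>v n" using B(2) v by simp
      moreover obtain b where "b < n" "j = f b" using \<open>j \<in> J\<close> J by auto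
      ultimately show ?thesis by (metis comp_apply index_vec index_zero_vec(1) v_def)
    qed
    then show "trivial_kernel m I J" unfolding trivial_kernel_def by blast
  next
    assume tk: "trivial_kernel m I J"
    have "det ?A \<noteq> 0"
    proof
      assume "det ?A = 0"
      then obtain v where v: "v \<in> carrier_vec n" "v \<noteq> 0\<^sub>v n" "?A *\<^sub>v v = 0\<^sub>v n"
        using det_0_iff_vec_prod_zero_field[OF A] by blast
      define x where "x j = v $ inv_into {..<n} f j" for j
      have x: "v $ b = x (f b)" if "b < n" for b
        using that f by (simp add: x_def bij_betw_def)
      have "(\<Sum>j\<in>J. m i j * x j) = 0" if i: "i \<in> I" for i
      proof -
        obtain a where "a < n" "i = e a" using i I by auto
        then show ?thesis using mult[OF _ v(1) x, of a] v(3) by simp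
      qed
      then have "\<forall>j\<in>J. x j = 0" using tk by (simp add: trivial_kernel_def)
      then have "v = 0\<^sub>v n" using v(1) x J by (intro eq_vecI) auto
      with v(2) show False by simp
    qed
    then have "?A \<in> Units (ring_mat TYPE('a) n ())"
      by (rule det_non_zero_imp_unit[OF A])
    then obtain B where "B \<in> carrier_mat n n" "?A * B = 1\<^sub>m n" "B * ?A = 1\<^sub>m n"
      by (auto simp: Units_def ring_mat_def)
    then show "invertible_mat ?A"
      unfolding invertible_mat_def inverts_mat_def
      by (intro conjI exI[of _ B]) auto
  qed
qed

lemma trivial_kernel_solvable:
  fixes m :: "nat \<Rightarrow> nat \<Rightarrow> 'a::field"
  assumes "finite I" "finite J" "card I = card J" "trivial_kernel m I J"
  obtains x where "\<And>i. i \<in> I \<Longrightarrow> (\<Sum>j\<in>J. m i j * x j) = y i"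
proof -
  define n where "n = card J"
  obtain e where e: "bij_betw e {..<n} I"
    using ex_bij_betw_nat_finite[OF assms(1)] assms(3) by (auto simp: n_def atLeast0LessThan)
  obtain f where f: "bij_betw f {..<n} J"
    using ex_bij_betw_nat_finite[OF assms(2)] by (auto simp: n_def atLeast0LessThan)
  let ?A = "mat n n (\<lambda>(a, b). m (e a) (f b))"
  have A: "?A \<in> carrier_mat n n" by simp
  have "invertible_mat ?A" using invertible_mat_iff_trivial_kernel[OF e f] assms(4) by blast
  then obtain B where B: "B \<in> carrier_mat n n" "?A * B = 1\<^sub>m n"
    using invertible_matE[OF A] by blast
  define v where "v = B *\<^sub>v vec n (y \<circ> e)"
  have v: "v \<in> carrier_vec n" using B(1) by (simp add: v_def)
  have Av: "?A *\<^sub>v v = vec n (y \<circ> e)"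
    unfolding v_def using assoc_mult_mat_vec[OF A B(1), of "vec n (y \<circ> e)"] B(2) by simp
  define x where "x j = v $ inv_into {..<n} f j" for j
  have x: "x (f b) = v $ b" if "b < n" for b
    using that f by (simp add: x_def bij_betw_def)
  have "(\<Sum>j\<in>J. m i j * x j) = y i" if i: "i \<in> I" for i
  proof -
    obtain a where a: "a < n" "i = e a" using i e by (auto simp: bij_betw_def)
    have "(\<Sum>j\<in>J. m i j * x j) = (\<Sum>b<n. m i (f b) * x (f b))"
      using sum.reindex_bij_betw[OF f, of "\<lambda>j. m i j * x j"] by simp
    also have "\<dots> = (?A *\<^sub>v v) $ a"
      using a v x by (auto simp: scalar_prod_def atLeast0LessThan intro!: sum.cong)
    finally show ?thesis using Av a by simp
  qed
  then show thesis using that by blast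
qed

lemma bij_betw_pick:
  assumes "finite I"
  shows "bij_betw (pick I) {..<card I} I"
proof -
  have "inj_on (pick I) {..<card I}"
    by (rule linorder_inj_onI') (metis lessThan_iff less_irrefl pick_mono_le)
  moreover have "pick I ` {..<card I} \<subseteq> I" using pick_in_set_le by auto
  ultimately show ?thesis
    using assms by (simp add: bij_betw_def card_image card_subset_eq)
qed

lemma invertible_submatrix_iff:
  fixes M :: "'a::field mat"
  assumes "I \<subseteq> {..<dim_row M}" "J \<subseteq> {..<dim_col M}" "card I = card J"
  shows "invertible_mat (submatrix M I J) \<longleftrightarrow> trivial_kernel (\<lambda>i j. M $$ (i, j)) I J"
proof -
  have "{i. i < dim_row M \<and> i \<in> I} = I" "{j. j < dim_col M \<and> j \<in> J} = J"
    using assms(1,2) by auto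
  then have "submatrix M I J = mat (card I) (card I) (\<lambda>(a, b). M $$ (pick I a, pick J b))"
    using assms(3) by (simp add: submatrix_def)
  moreover have "finite I" "finite J" using assms(1,2) finite_subset by blast+
  then have "bij_betw (pick I) {..<card I} I" "bij_betw (pick J) {..<card I} J"
    using bij_betw_pick assms(3) by metis+
  then have "invertible_mat (mat (card I) (card I) (\<lambda>(a, b). M $$ (pick I a, pick J b))) \<longleftrightarrow>
      trivial_kernel (\<lambda>i j. M $$ (i, j)) I J"
    by (rule invertible_mat_iff_trivial_kernel)
  ultimately show ?thesis by simp
qed

section \<open>Generic rows with prescribed hyperplanes\<close>

text \<open>This replaces Laplace expansion along a new row. For one row too few, the kernel is spanned by
  the vector \<open>d\<close> of signed maximal minors; adding a row \<open>v\<close> gives an invertible block exactly when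
  \<open>\<Sum>j\<in>J. v j * d j \<noteq> 0\<close>. That no entry \<open>d j\<close> vanishes on \<open>J\<close> says that all the maximal minors
  are nonzero.\<close>

lemma kernel_line:
  fixes m :: "nat \<Rightarrow> nat \<Rightarrow> 'a::field"
  assumes "finite I" "finite J" "card J = Suc (card I)"
    and minors: "\<And>j. j \<in> J \<Longrightarrow> trivial_kernel m I (J - {j})"
  shows "\<exists>d. (\<forall>j. d j \<noteq> 0 \<longleftrightarrow> j \<in> J) \<and> (\<forall>i\<in>I. (\<Sum>j\<in>J. m i j * d j) = 0) \<and>
    (\<forall>x. (\<forall>i\<in>I. (\<Sum>j\<in>J. m i j * x j) = 0) \<longrightarrow> (\<exists>c. \<forall>j\<in>J. x j = c * d j))"
proof -
  \<comment> \<open>A kernel vector that vanishes in one place solves a system with trivial kernel.\<close>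
  have drop: "\<forall>l\<in>J. x l = 0"
    if j: "j \<in> J" "x j = 0" and ker: "\<And>i. i \<in> I \<Longrightarrow> (\<Sum>l\<in>J. m i l * x l) = 0" for x j
  proof -
    have "(\<Sum>l\<in>J - {j}. m i l * x l) = 0" if "i \<in> I" for i
      using ker[OF that] sum.remove[OF assms(2) j(1), of "\<lambda>l. m i l * x l"] j(2) by simp
    then have "\<forall>l\<in>J - {j}. x l = 0" using minors[OF j(1)] by (simp add: trivial_kernel_def)
    then show ?thesis using j(2) by blast
  qed
  obtain j0 where j0: "j0 \<in> J" using assms(3) by fastforce
  have "card I = card (J - {j0})" using j0 assms(2,3) by simp
  then obtain x where x: "\<And>i. i \<in> I \<Longrightarrow> (\<Sum>j\<in>J - {j0}. m i j * x j) = - m i j0"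
    using trivial_kernel_solvable[OF assms(1) _ _ minors[OF j0], of "\<lambda>i. - m i j0"] assms(2) by blast
  \<comment> \<open>Normalise the entry at \<open>j0\<close> to 1 and solve for the others.\<close>
  define d where "d j = (if j = j0 then 1 else if j \<in> J then x j else 0)" for j
  have ker: "(\<Sum>j\<in>J. m i j * d j) = 0" if "i \<in> I" for i
  proof -
    have "(\<Sum>j\<in>J. m i j * d j) = m i j0 + (\<Sum>j\<in>J - {j0}. m i j * d j)"
      using sum.remove[OF assms(2) j0, of "\<lambda>j. m i j * d j"] by (simp add: d_def)
    also have "(\<Sum>j\<in>J - {j0}. m i j * d j) = (\<Sum>j\<in>J - {j0}. m i j * x j)"
      by (rule sum.cong) (auto simp: d_def)
    finally show ?thesis using x[OF that] by simp
  qed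
  show ?thesis
  proof (intro exI[of _ d] conjI allI ballI impI)
    show "d j \<noteq> 0 \<longleftrightarrow> j \<in> J" for j
    proof
      show "j \<in> J" if "d j \<noteq> 0" using that j0 by (auto simp: d_def split: if_splits)
      show "d j \<noteq> 0" if "j \<in> J"
      proof
        assume "d j = 0"
        then have "d j0 = 0" using drop[OF that _ ker] j0 by blast
        then show False by (simp add: d_def)
      qed
    qed
  next
    fix y assume y: "\<forall>i\<in>I. (\<Sum>j\<in>J. m i j * y j) = 0"
    have "\<forall>j\<in>J. y j - y j0 * d j = 0"
    proof (rule drop[OF j0])
      show "y j0 - y j0 * d j0 = 0" by (simp add: d_def)
      show "(\<Sum>j\<in>J. m i j * (y j - y j0 * d j)) = 0" if "i \<in> I" for i
      proof -
        have "(\<Sum>j\<in>J. m i j * (y j - y j0 * d j)) =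
            (\<Sum>j\<in>J. m i j * y j) - y j0 * (\<Sum>j\<in>J. m i j * d j)"
          by (simp add: algebra_simps sum_subtractf sum_distrib_left)
        then show ?thesis using bspec[OF y that] ker[OF that] by simp
      qed
    qed
    then show "\<exists>c. \<forall>j\<in>J. y j = c * d j" by (intro exI[of _ "y j0"]) simp
  qed (rule ker)
qed

definition monochromatic :: "(nat \<Rightarrow> nat) \<Rightarrow> nat set \<Rightarrow> bool" where
  "monochromatic \<beta> I \<longleftrightarrow> (\<exists>c. \<forall>i\<in>I. \<beta> i = c)"

text \<open>A point of a curve that spans the hyperplane \<open>x n = (c + 1) * (\<Sum>j<n. x j)\<close> of colour \<open>c\<close> in
  \<open>(n + 1)\<close>-space. The shift by one keeps all entries of the normal vector nonzero for the
  colour 0 as well.\<close>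

definition row_at :: "nat \<Rightarrow> nat \<Rightarrow> complex \<Rightarrow> nat \<Rightarrow> complex" where
  "row_at n c t j = (if j < n then t ^ j else of_nat (Suc c) * (\<Sum>l<n. t ^ l))"

text \<open>With \<open>d\<close> as in \<open>kernel_line\<close>, the new row at parameter \<open>t\<close> pairs with \<open>d\<close> to a polynomial \<open>q\<close> in \<open>t\<close>.
  If \<open>q\<close> were zero, \<open>d\<close> would be proportional to the normal vector of the hyperplane of the
  new row's colour. That vector has full support, so \<open>J\<close> would consist of all columns, and it is
  orthogonal to all rows in \<open>I\<close>, so these would lie in that hyperplane. But a row lies only in the
  hyperplane of its own colour, because the sum of its first \<open>n\<close> entries is nonzero. So all rows
  would have one colour.\<close>

lemma extend_by_row:
  fixes m :: "nat \<Rightarrow> nat \<Rightarrow> complex"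
  assumes hyper: "\<And>i. i \<in> I \<Longrightarrow>
        m i n = of_nat (Suc (\<beta> i)) * (\<Sum>j<n. m i j) \<and> (\<Sum>j<n. m i j) \<noteq> 0"
    and "finite I" "r \<notin> I" "J \<subseteq> {..<Suc n}" "card J = Suc (card I)"
    and minors: "\<And>j. j \<in> J \<Longrightarrow> trivial_kernel m I (J - {j})"
    and not_mono: "\<not> (J = {..<Suc n} \<and> monochromatic \<beta> (insert r I))"
  shows "\<exists>q. q \<noteq> 0 \<and>
    (\<forall>t. poly q t \<noteq> 0 \<longrightarrow> trivial_kernel (m(r := row_at n (\<beta> r) t)) (insert r I) J)"
proof -
  have "finite J" using assms(4) finite_subset by blast
  have "\<exists>d. (\<forall>j. d j \<noteq> 0 \<longleftrightarrow> j \<in> J) \<and> (\<forall>i\<in>I. (\<Sum>j\<in>J. m i j * d j) = 0) \<and>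
    (\<forall>x. (\<forall>i\<in>I. (\<Sum>j\<in>J. m i j * x j) = 0) \<longrightarrow> (\<exists>c. \<forall>j\<in>J. x j = c * d j))"
    using assms(2) \<open>finite J\<close> assms(5) minors by (rule kernel_line)
  then obtain d where D: "\<forall>j. d j \<noteq> 0 \<longleftrightarrow> j \<in> J" "\<forall>i\<in>I. (\<Sum>j\<in>J. m i j * d j) = 0"
    "\<forall>x. (\<forall>i\<in>I. (\<Sum>j\<in>J. m i j * x j) = 0) \<longrightarrow> (\<exists>c. \<forall>j\<in>J. x j = c * d j)"
    by (elim exE conjE) (rule that)
  note d = spec[OF D(1)] and dI = bspec[OF D(2)] and line = mp[OF spec[OF D(3)]]
  have sumJ: "(\<Sum>j\<in>J. f j * d j) = (\<Sum>j<n. f j * d j) + f n * d n" for f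
  proof -
    have "(\<Sum>j\<in>J. f j * d j) = (\<Sum>j<Suc n. f j * d j)"
      using assms(4) d by (intro sum.mono_neutral_left) auto
    then show ?thesis by simp
  qed
  define c where "c = (of_nat (Suc (\<beta> r)) :: complex)"
  have "c \<noteq> 0" unfolding c_def by (rule of_nat_neq_0)
  define q where "q = (\<Sum>j<n. monom (d j + c * d n) j)"
  have coeff_q: "coeff q j = d j + c * d n" if "j < n" for j
    using that by (simp add: q_def coeff_sum)
  have poly_q: "poly q t = (\<Sum>j\<in>J. row_at n (\<beta> r) t j * d j)" for t
  proof -
    have "(\<Sum>j\<in>J. row_at n (\<beta> r) t j * d j) = (\<Sum>j<n. t ^ j * d j) + c * (\<Sum>l<n. t ^ l) * d n"
      unfolding sumJ by (simp add: row_at_def c_def)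
    then show ?thesis
      by (simp add: q_def poly_sum poly_monom algebra_simps sum.distrib sum_distrib_left)
  qed
  have "q \<noteq> 0"
  proof
    assume "q = 0"
    then have dj: "d j = - c * d n" if "j < n" for j
      using coeff_q[OF that] by (simp add: add_eq_0_iff2)
    obtain j where "j \<in> J" using assms(5) by fastforce
    then have "d n \<noteq> 0" using dj[of j] d[of j] assms(4) by (cases "j = n") auto
    then have "d j \<noteq> 0" if "j < Suc n" for j
      using dj[of j] that \<open>c \<noteq> 0\<close> by (cases "j = n") auto
    then have J: "J = {..<Suc n}" using d assms(4) by auto
    have "\<beta> i = \<beta> r" if "i \<in> I" for i
    proof -
      have "0 = (\<Sum>j<n. m i j * d j) + m i n * d n" using dI[OF that] sumJ by metis
      also have "(\<Sum>j<n. m i j * d j) = - c * d n * (\<Sum>j<n. m i j)"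
        by (simp add: dj sum_distrib_left algebra_simps)
      finally have "(of_nat (Suc (\<beta> i)) - c) * ((\<Sum>j<n. m i j) * d n) = 0"
        using hyper[OF that] by (simp add: algebra_simps)
      then have "(of_nat (Suc (\<beta> i)) :: complex) = of_nat (Suc (\<beta> r))"
        using hyper[OF that] \<open>d n \<noteq> 0\<close> by (simp add: c_def)
      then show ?thesis by (simp only: of_nat_eq_iff nat.inject)
    qed
    then have "monochromatic \<beta> (insert r I)" unfolding monochromatic_def by blast
    then show False using not_mono J by blast
  qed
  moreover have "trivial_kernel (m(r := row_at n (\<beta> r) t)) (insert r I) J" if t: "poly q t \<noteq> 0" for t
    unfolding trivial_kernel_def
  proof (intro allI impI)
    fix x assume x: "\<forall>i\<in>insert r I. (\<Sum>j\<in>J. (m(r := row_at n (\<beta> r) t)) i j * x j) = 0"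
    have "\<forall>i\<in>I. (\<Sum>j\<in>J. m i j * x j) = 0"
    proof
      show "(\<Sum>j\<in>J. m i j * x j) = 0" if "i \<in> I" for i
        using bspec[OF x, of i] that assms(3) by (cases "i = r") auto
    qed
    from line[OF this] obtain a where a: "\<forall>j\<in>J. x j = a * d j" ..
    have "0 = (\<Sum>j\<in>J. row_at n (\<beta> r) t j * x j)" using bspec[OF x, of r] by simp
    also have "\<dots> = a * poly q t"
      unfolding poly_q sum_distrib_left using a by (intro sum.cong) auto
    finally show "\<forall>j\<in>J. x j = 0" using a t by simp
  qed
  ultimately show ?thesis by blast
qed

text \<open>Rows in general position subject to one linear relation per colour: the only obstruction to
  invertibility is that a full set of columns meets rows inside one hyperplane. Each row is a point
  of its curve outside the finitely many roots of the polynomials attached to the blocks that end in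
  that row; a positive parameter keeps the sum of the first entries nonzero.\<close>

lemma generic_coloured_rows:
  assumes "n \<ge> 1"
  shows "\<exists>m :: nat \<Rightarrow> nat \<Rightarrow> complex.
    (\<forall>i<r. m i n = of_nat (Suc (\<beta> i)) * (\<Sum>j<n. m i j) \<and> (\<Sum>j<n. m i j) \<noteq> 0) \<and>
    (\<forall>I J. I \<subseteq> {..<r} \<longrightarrow> J \<subseteq> {..<Suc n} \<longrightarrow> card I = card J \<longrightarrow>
       \<not> (J = {..<Suc n} \<and> monochromatic \<beta> I) \<longrightarrow> trivial_kernel m I J)"
proof (induction r)
  case 0
  have "J = {}" if "J \<subseteq> {..<Suc n}" "card J = 0" for J
    using that finite_subset[OF that(1)] by simp
  then show ?case by (intro exI[of _ "\<lambda>_ _. 0"]) (auto simp: trivial_kernel_def)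
next
  case (Suc r)
  then obtain m :: "nat \<Rightarrow> nat \<Rightarrow> complex" where
    hyper: "\<And>i. i < r \<Longrightarrow> m i n = of_nat (Suc (\<beta> i)) * (\<Sum>j<n. m i j) \<and> (\<Sum>j<n. m i j) \<noteq> 0"
    and tk: "\<And>I J. I \<subseteq> {..<r} \<Longrightarrow> J \<subseteq> {..<Suc n} \<Longrightarrow> card I = card J \<Longrightarrow>
       \<not> (J = {..<Suc n} \<and> monochromatic \<beta> I) \<Longrightarrow> trivial_kernel m I J"
    by blast
  \<comment> \<open>The blocks that become testable with row \<open>r\<close>, listed without that row.\<close>
  define P where "P = {(I, J). I \<subseteq> {..<r} \<and> J \<subseteq> {..<Suc n} \<and> card J = Suc (card I) \<and>
    \<not> (J = {..<Suc n} \<and> monochromatic \<beta> (insert r I))}"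
  define new where "new t = m(r := row_at n (\<beta> r) t)" for t
  have "\<exists>q. q \<noteq> 0 \<and> (\<forall>t. poly q t \<noteq> 0 \<longrightarrow> trivial_kernel (new t) (insert r I) J)"
    if "(I, J) \<in> P" for I J
    unfolding new_def
  proof (rule extend_by_row)
    have IJ: "I \<subseteq> {..<r}" "J \<subseteq> {..<Suc n}" "card J = Suc (card I)"
      "\<not> (J = {..<Suc n} \<and> monochromatic \<beta> (insert r I))"
      using that by (auto simp: P_def)
    then have fin: "finite I" "finite J" by (meson finite_lessThan finite_subset)+
    show "finite I" by fact
    show "r \<notin> I" using IJ(1) by auto
    show "J \<subseteq> {..<Suc n}" "card J = Suc (card I)"
      "\<not> (J = {..<Suc n} \<and> monochromatic \<beta> (insert r I))" by fact+
    show "m i n = of_nat (Suc (\<beta> i)) * (\<Sum>j<n. m i j) \<and> (\<Sum>j<n. m i j) \<noteq> 0" if "i \<in> I" for i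
      using hyper that IJ(1) by blast
    show "trivial_kernel m I (J - {j})" if "j \<in> J" for j
      using tk[OF IJ(1), of "J - {j}"] IJ(2,3) fin that by auto
  qed
  then have "\<forall>p\<in>P. \<exists>q. q \<noteq> 0 \<and> (\<forall>t. poly q t \<noteq> 0 \<longrightarrow>
      trivial_kernel (new t) (insert r (fst p)) (snd p))"
    by auto
  then obtain q where q0: "\<And>p. p \<in> P \<Longrightarrow> q p \<noteq> 0"
    and q: "\<And>I J t. (I, J) \<in> P \<Longrightarrow> poly (q (I, J)) t \<noteq> 0 \<Longrightarrow> trivial_kernel (new t) (insert r I) J"
    using bchoice[of P "\<lambda>p q. q \<noteq> 0 \<and> (\<forall>t. poly q t \<noteq> 0 \<longrightarrow>
      trivial_kernel (new t) (insert r (fst p)) (snd p))"] by fastforce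
  have "P \<subseteq> Pow {..<r} \<times> Pow {..<Suc n}" by (auto simp: P_def)
  then have "finite P" by (rule finite_subset) simp
  then have "finite (\<Union>p\<in>P. {t. poly (q p) t = 0})"
    using q0 poly_roots_finite by blast
  moreover have "infinite (range (\<lambda>s. of_nat (Suc s) :: complex))"
    by (intro range_inj_infinite injI) (metis Suc_inject of_nat_eq_iff)
  ultimately obtain s where s: "of_nat (Suc s) \<notin> (\<Union>p\<in>P. {t. poly (q p) t = 0})"
    by (metis (no_types, lifting) finite_subset image_subsetI)
  define t where "t = (of_nat (Suc s) :: complex)"
  have geom: "(\<Sum>j<n. t ^ j) \<noteq> 0"
  proof -
    have "(\<Sum>j<n. Suc s ^ j) \<noteq> 0" using assms by (auto simp: sum_eq_0_iff intro!: exI[of _ 0])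
    then have "of_nat (\<Sum>j<n. Suc s ^ j) \<noteq> (0 :: complex)" by (metis of_nat_eq_0_iff)
    then show ?thesis by (simp add: t_def)
  qed
  show ?case
  proof (intro exI[of _ "new t"] conjI allI impI)
    fix i assume "i < Suc r"
    then show "new t i n = of_nat (Suc (\<beta> i)) * (\<Sum>j<n. new t i j)" "(\<Sum>j<n. new t i j) \<noteq> 0"
      using hyper[of i] geom by (cases "i = r"; simp add: new_def row_at_def)+
  next
    fix I J
    assume IJ: "I \<subseteq> {..<Suc r}" "J \<subseteq> {..<Suc n}" "card I = card J"
      "\<not> (J = {..<Suc n} \<and> monochromatic \<beta> I)"
    show "trivial_kernel (new t) I J"
    proof (cases "r \<in> I")
      case False
      then have "I \<subseteq> {..<r}" using IJ(1) by (auto simp: lessThan_Suc)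
      then have "trivial_kernel m I J" using tk IJ by blast
      moreover have "new t i = m i" if "i \<in> I" for i using False that by (auto simp: new_def)
      ultimately show ?thesis using trivial_kernel_cong[of I J m "new t"] by auto
    next
      case True
      then obtain I0 where I0: "I = insert r I0" "r \<notin> I0" by (meson mk_disjoint_insert)
      have "I0 \<subseteq> {..<r}" using I0 IJ(1) by (auto simp: lessThan_Suc)
      moreover from this have "finite I0" using finite_subset by blast
      ultimately have "(I0, J) \<in> P" using IJ I0 by (auto simp: P_def)
      then show ?thesis using q[of I0 J t] s I0(1) by (auto simp: t_def)
    qed
  qed
qed

section \<open>Square submatrices and maximal minors\<close>

definition balanced_pairs :: "nat \<Rightarrow> nat \<Rightarrow> (nat set \<times> nat set) set" where
  "balanced_pairs r k = {(I, J). I \<subseteq> {..<r} \<and> J \<subseteq> {..<k} \<and> card I = card J}"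

definition regular_pairs :: "(nat \<Rightarrow> nat \<Rightarrow> 'a::field) \<Rightarrow> nat \<Rightarrow> nat \<Rightarrow> (nat set \<times> nat set) set" where
  "regular_pairs m r k = {(I, J) \<in> balanced_pairs r k. trivial_kernel m I J}"

text \<open>In the matrix \<open>(1 | m)\<close> with \<open>r\<close> rows, the columns complementary to \<open>I\<close> in the identity together
  with the columns \<open>J\<close> of \<open>m\<close>: eliminating with the identity columns leaves the block of \<open>m\<close> on
  \<open>I\<close> and \<open>J\<close>.\<close>

definition dual_columns :: "nat \<Rightarrow> nat set \<times> nat set \<Rightarrow> nat set" where
  "dual_columns r = (\<lambda>(I, J). ({..<r} - I) \<union> (+) r ` J)"

lemma card_dual_columns:
  assumes "I \<subseteq> {..<r}" "finite J"
  shows "card (dual_columns r (I, J)) + card I = r + card J"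
proof -
  have fin: "finite I" using assms(1) finite_subset by blast
  have "card (dual_columns r (I, J)) = card ({..<r} - I) + card ((+) r ` J)"
    unfolding dual_columns_def prod.case using assms(2) by (intro card_Un_disjoint) auto
  moreover have "card ({..<r} - I) + card I = r"
    using card_Diff_subset[OF fin assms(1)] card_mono[OF _ assms(1)] by simp
  moreover have "card ((+) r ` J) = card J" by (simp add: card_image)
  ultimately show ?thesis by linarith
qed

lemma bij_betw_dual_columns:
  "bij_betw (dual_columns r) (balanced_pairs r k) {K. K \<subseteq> {..<r + k} \<and> card K = r}"
proof (rule bij_betw_byWitness[where f' = "\<lambda>K. ({..<r} - K, {j. r + j \<in> K})"])
  show "\<forall>p\<in>balanced_pairs r k. ({..<r} - dual_columns r p, {j. r + j \<in> dual_columns r p}) = p"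
    by (auto simp: balanced_pairs_def dual_columns_def)
  have inv: "dual_columns r ({..<r} - K, {j. r + j \<in> K}) = K" for K
  proof (intro equalityI subsetI)
    show "x \<in> dual_columns r ({..<r} - K, {j. r + j \<in> K})" if "x \<in> K" for x
      using that by (cases "x < r") (auto simp: dual_columns_def image_iff intro!: exI[of _ "x - r"])
  qed (auto simp: dual_columns_def)
  then show "\<forall>K\<in>{K. K \<subseteq> {..<r + k} \<and> card K = r}.
      dual_columns r ({..<r} - K, {j. r + j \<in> K}) = K"
    by blast
  show "dual_columns r ` balanced_pairs r k \<subseteq> {K. K \<subseteq> {..<r + k} \<and> card K = r}"
  proof safe
    fix I J assume "(I, J) \<in> balanced_pairs r k"
    then have IJ: "I \<subseteq> {..<r}" "J \<subseteq> {..<k}" "card I = card J" by (auto simp: balanced_pairs_def)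
    then show "card (dual_columns r (I, J)) = r"
      using card_dual_columns[of I r J] finite_subset[of J] by simp
    show "x < r + k" if "x \<in> dual_columns r (I, J)" for x
      using that IJ by (auto simp: dual_columns_def)
  qed
  show "(\<lambda>K. ({..<r} - K, {j. r + j \<in> K})) ` {K. K \<subseteq> {..<r + k} \<and> card K = r} \<subseteq> balanced_pairs r k"
  proof (rule image_subsetI)
    fix K assume K: "K \<in> {K. K \<subseteq> {..<r + k} \<and> card K = r}"
    have J: "{j. r + j \<in> K} \<subseteq> {..<k}" using K by auto
    then have "card K + card ({..<r} - K) = r + card {j. r + j \<in> K}"
      using card_dual_columns[of "{..<r} - K" r "{j. r + j \<in> K}"] inv[of K]
        finite_subset[OF J] by simp
    then show "({..<r} - K, {j. r + j \<in> K}) \<in> balanced_pairs r k"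
      using K J by (auto simp: balanced_pairs_def)
  qed
qed

lemma card_balanced_pairs: "card (balanced_pairs r k) = (r + k) choose k"
proof -
  have "card (balanced_pairs r k) = card {K. K \<subseteq> {..<r + k} \<and> card K = r}"
    by (rule bij_betw_same_card[OF bij_betw_dual_columns])
  also have "\<dots> = (r + k) choose k"
    using n_subsets[of "{..<r + k}" r] binomial_symmetric[of r "r + k"] by simp
  finally show ?thesis .
qed

lemma finite_balanced_pairs: "finite (balanced_pairs r k)"
  by (rule finite_subset[of _ "Pow {..<r} \<times> Pow {..<k}"]) (auto simp: balanced_pairs_def)

text \<open>A row outside \<open>I\<close> contains exactly one selected identity column, so it determines the unknown of
  that column from those of \<open>J\<close>; the rows in \<open>I\<close> contain none and give the system of the block.\<close>

lemma trivial_kernel_dual_columns: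
  fixes m :: "nat \<Rightarrow> nat \<Rightarrow> 'a::field"
  assumes "(I, J) \<in> balanced_pairs r k"
  defines "h \<equiv> \<lambda>i l. if l < r then (if i = l then 1 else 0) else m i (l - r)"
  shows "trivial_kernel h {..<r} (dual_columns r (I, J)) \<longleftrightarrow> trivial_kernel m I J"
proof -
  have I: "I \<subseteq> {..<r}" and "finite J"
    using assms(1) finite_subset by (auto simp: balanced_pairs_def)
  have sums: "(\<Sum>l\<in>dual_columns r (I, J). h i l * y l) =
      (if i \<in> I then 0 else y i) + (\<Sum>j\<in>J. m i j * y (r + j))" if "i < r" for i y
  proof -
    have "(\<Sum>l\<in>dual_columns r (I, J). h i l * y l) =
        (\<Sum>l\<in>{..<r} - I. h i l * y l) + (\<Sum>l\<in>(+) r ` J. h i l * y l)"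
      unfolding dual_columns_def prod.case using \<open>finite J\<close> by (intro sum.union_disjoint) auto
    also have "(\<Sum>l\<in>{..<r} - I. h i l * y l) = (\<Sum>l\<in>{..<r} - I. if l = i then y l else 0)"
      by (rule sum.cong) (auto simp: h_def)
    also have "\<dots> = (if i \<in> I then 0 else y i)" using that by simp
    also have "(\<Sum>l\<in>(+) r ` J. h i l * y l) = (\<Sum>j\<in>J. m i j * y (r + j))"
      by (subst sum.reindex) (auto simp: h_def)
    finally show ?thesis .
  qed
  show ?thesis
  proof
    assume tk: "trivial_kernel h {..<r} (dual_columns r (I, J))"
    show "trivial_kernel m I J"
      unfolding trivial_kernel_def
    proof (intro allI impI)
      fix x assume x: "\<forall>i\<in>I. (\<Sum>j\<in>J. m i j * x j) = 0"
      define y where "y l = (if l < r then - (\<Sum>j\<in>J. m l j * x j) else x (l - r))" for l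
      have "\<forall>i\<in>{..<r}. (\<Sum>l\<in>dual_columns r (I, J). h i l * y l) = 0"
        using x by (auto simp: sums y_def)
      then have "\<forall>l\<in>dual_columns r (I, J). y l = 0" using tk by (simp add: trivial_kernel_def)
      then have "y (r + j) = 0" if "j \<in> J" for j using that by (auto simp: dual_columns_def)
      then show "\<forall>j\<in>J. x j = 0" by (auto simp: y_def)
    qed
  next
    assume tk: "trivial_kernel m I J"
    show "trivial_kernel h {..<r} (dual_columns r (I, J))"
      unfolding trivial_kernel_def
    proof (intro allI impI)
      fix y assume y: "\<forall>i\<in>{..<r}. (\<Sum>l\<in>dual_columns r (I, J). h i l * y l) = 0"
      have "\<forall>i\<in>I. (\<Sum>j\<in>J. m i j * y (r + j)) = 0"
      proof
        show "(\<Sum>j\<in>J. m i j * y (r + j)) = 0" if "i \<in> I" for i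
          using y sums[of i y] I that by auto
      qed
      then have J0: "\<forall>j\<in>J. y (r + j) = 0"
        using spec[OF tk[unfolded trivial_kernel_def], of "\<lambda>j. y (r + j)"] by blast
      moreover have "y l = 0" if "l \<in> {..<r} - I" for l
        using y sums[of l y] J0 that by simp
      ultimately show "\<forall>l\<in>dual_columns r (I, J). y l = 0"
        by (auto simp: dual_columns_def)
    qed
  qed
qed

lemma rkb_star_matrix_of_regular_pairs:
  "rkb_star_matrix r k (card (regular_pairs m r k)) (mat r k (\<lambda>(i, j). m i j))"
proof -
  let ?M = "mat r k (\<lambda>(i, j). m i j)"
  have "invertible_mat (submatrix ?M I J) \<longleftrightarrow> trivial_kernel m I J"
    if "I \<subseteq> {..<r}" "J \<subseteq> {..<k}" "card I = card J" for I J
  proof -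
    have "invertible_mat (submatrix ?M I J) \<longleftrightarrow> trivial_kernel (\<lambda>i j. ?M $$ (i, j)) I J"
      by (rule invertible_submatrix_iff) (use that in auto)
    also have "\<dots> \<longleftrightarrow> trivial_kernel m I J"
      by (rule trivial_kernel_cong) (use that in \<open>auto simp: subset_iff\<close>)
    finally show ?thesis .
  qed
  then have "inv_square_submatrices ?M = regular_pairs m r k"
    by (auto simp: inv_square_submatrices_def regular_pairs_def balanced_pairs_def)
  then show ?thesis by (simp add: rkb_star_matrix_def)
qed

lemma nrb_matrix_of_regular_pairs:
  "nrb_matrix (r + k) r (card (regular_pairs m r k))
     (mat r (r + k) (\<lambda>(i, l). if l < r then (if i = l then 1 else 0) else m i (l - r)))"
    (is "nrb_matrix _ _ _ ?N")
proof -
  let ?h = "\<lambda>i l. if l < r then (if i = l then 1 else 0) else m i (l - r)"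
  let ?S = "{K. K \<subseteq> {..<r + k} \<and> card K = r \<and> invertible_mat (submatrix ?N {..<r} K)}"
  have bij: "bij_betw (dual_columns r) (balanced_pairs r k) {K. K \<subseteq> {..<r + k} \<and> card K = r}"
    by (rule bij_betw_dual_columns)
  have inv: "invertible_mat (submatrix ?N {..<r} K) \<longleftrightarrow> trivial_kernel ?h {..<r} K"
    if "K \<subseteq> {..<r + k}" "card K = r" for K
  proof -
    have "invertible_mat (submatrix ?N {..<r} K) \<longleftrightarrow>
        trivial_kernel (\<lambda>i l. ?N $$ (i, l)) {..<r} K"
      by (rule invertible_submatrix_iff) (use that in auto)
    also have "\<dots> \<longleftrightarrow> trivial_kernel ?h {..<r} K"
      by (rule trivial_kernel_cong) (use that in auto)
    finally show ?thesis .
  qed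
  have "?S = dual_columns r ` regular_pairs m r k"
  proof (intro equalityI subsetI)
    fix K assume K: "K \<in> ?S"
    then have "K \<in> dual_columns r ` balanced_pairs r k"
      using bij by (simp add: bij_betw_def)
    then obtain I J where IJ: "K = dual_columns r (I, J)" "(I, J) \<in> balanced_pairs r k" by auto
    then have "trivial_kernel m I J"
      using K inv[of K] trivial_kernel_dual_columns[OF IJ(2), of m] by simp
    then show "K \<in> dual_columns r ` regular_pairs m r k"
      using IJ by (auto simp: regular_pairs_def)
  next
    fix K assume "K \<in> dual_columns r ` regular_pairs m r k"
    then obtain I J where IJ: "K = dual_columns r (I, J)" "(I, J) \<in> balanced_pairs r k"
      "trivial_kernel m I J"
      by (auto simp: regular_pairs_def)
    have "K \<in> {K. K \<subseteq> {..<r + k} \<and> card K = r}"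
      using bij_betwE[OF bij] IJ(1,2) by blast
    then show "K \<in> ?S"
      using inv[of K] IJ trivial_kernel_dual_columns[OF IJ(2), of m] by simp
  qed
  moreover have "inj_on (dual_columns r) (regular_pairs m r k)"
    by (rule inj_on_subset[OF bij_betw_imp_inj_on[OF bij]]) (auto simp: regular_pairs_def)
  ultimately have "card ?S = card (regular_pairs m r k)" by (simp add: card_image)
  then show ?thesis by (simp add: nrb_matrix_def)
qed

text \<open>Counts that occur with few rows also occur with more. A block with a zero row is not invertible,
  since its system cannot be solved for the right-hand side 1 in that row.\<close>

lemma regular_pairs_pad_zero_rows:
  fixes m :: "nat \<Rightarrow> nat \<Rightarrow> 'a::field"
  assumes "s \<le> r"
  shows "regular_pairs (\<lambda>i j. if i < s then m i j else 0) r k = regular_pairs m s k"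
proof -
  let ?m = "\<lambda>i j. if i < s then m i j else 0"
  have same: "trivial_kernel ?m I J \<longleftrightarrow> trivial_kernel m I J" if "I \<subseteq> {..<s}" for I J
    by (rule trivial_kernel_cong) (use that in auto)
  have sub: "I \<subseteq> {..<s}" if IJ: "(I, J) \<in> balanced_pairs r k" and tk: "trivial_kernel ?m I J" for I J
  proof (rule ccontr)
    assume "\<not> I \<subseteq> {..<s}"
    then obtain i where i: "i \<in> I" "\<not> i < s" by auto
    have fin: "finite I" "finite J" and "card I = card J"
      using IJ finite_subset by (auto simp: balanced_pairs_def)
    then obtain x where "\<And>i. i \<in> I \<Longrightarrow> (\<Sum>j\<in>J. ?m i j * x j) = 1"
      using trivial_kernel_solvable[OF _ _ _ tk, of "\<lambda>_. 1"] by metis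
    from this[OF i(1)] i(2) show False by simp
  qed
  have "(I, J) \<in> regular_pairs ?m r k \<longleftrightarrow> (I, J) \<in> regular_pairs m s k" for I J
  proof (cases "I \<subseteq> {..<s}")
    case True
    then have "(I, J) \<in> balanced_pairs r k \<longleftrightarrow> (I, J) \<in> balanced_pairs s k"
      using assms by (auto simp: balanced_pairs_def)
    then show ?thesis using same[OF True] by (simp add: regular_pairs_def)
  next
    case False
    then have "(I, J) \<notin> balanced_pairs s k" by (simp add: balanced_pairs_def)
    moreover have "(I, J) \<notin> regular_pairs ?m r k" using sub False by (auto simp: regular_pairs_def)
    ultimately show ?thesis by (simp add: regular_pairs_def)
  qed
  then show ?thesis by auto
qed

text \<open>A single nonzero column with \<open>b - 1\<close> entries 1 has, besides the empty block, exactly these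
  entries as invertible blocks.\<close>

lemma ex_card_regular_pairs_le_Suc:
  assumes "1 \<le> b" "b \<le> Suc r" "k \<ge> 1"
  shows "\<exists>m :: nat \<Rightarrow> nat \<Rightarrow> complex. card (regular_pairs m r k) = b"
proof -
  define m where "m i j = (if j = 0 \<and> i < b - 1 then 1 else 0 :: complex)" for i j :: nat
  have "regular_pairs m r k = insert ({}, {}) ((\<lambda>i. ({i}, {0})) ` {..<b - 1})"
  proof (intro equalityI subsetI)
    fix p assume "p \<in> regular_pairs m r k"
    then obtain I J where p: "p = (I, J)" and IJ: "I \<subseteq> {..<r}" "J \<subseteq> {..<k}" "card I = card J"
      and tk: "trivial_kernel m I J"
      by (auto simp: regular_pairs_def balanced_pairs_def)
    have fin: "finite I" "finite J" using IJ finite_subset by blast+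
    have "j = 0" if "j \<in> J" for j
    proof (rule ccontr)
      assume "j \<noteq> 0"
      then have "(\<Sum>l\<in>J. m i l * (if l = j then 1 else 0)) = 0" for i
        by (intro sum.neutral) (auto simp: m_def)
      then show False
        using spec[OF tk[unfolded trivial_kernel_def], of "\<lambda>l. if l = j then 1 else 0"] that by auto
    qed
    then consider "J = {}" | "J = {0}" by blast
    then show "p \<in> insert ({}, {}) ((\<lambda>i. ({i}, {0})) ` {..<b - 1})"
    proof cases
      case 1
      then show ?thesis using IJ(3) fin p by simp
    next
      case 2
      then obtain i where i: "I = {i}" using IJ(3) by (auto simp: card_1_singleton_iff)
      have "i < b - 1"
      proof (rule ccontr)
        assume "\<not> i < b - 1"
        then show False
          using spec[OF tk[unfolded trivial_kernel_def], of "\<lambda>_. 1"] i 2 by (simp add: m_def)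
      qed
      then show ?thesis using p i 2 by simp
    qed
  next
    fix p assume "p \<in> insert ({}, {}) ((\<lambda>i. ({i}, {0 :: nat})) ` {..<b - 1})"
    then show "p \<in> regular_pairs m r k"
      using assms by (auto simp: regular_pairs_def balanced_pairs_def trivial_kernel_def m_def)
  qed
  moreover have "card (insert ({}, {}) ((\<lambda>i. ({i}, {0 :: nat})) ` {..<b - 1})) = b"
  proof -
    have "inj_on (\<lambda>i. ({i}, {0 :: nat})) {..<b - 1}" by (auto simp: inj_on_def)
    moreover have "({}, {}) \<notin> (\<lambda>i. ({i}, {0 :: nat})) ` {..<b - 1}" by auto
    ultimately show ?thesis using assms(1) by (simp add: card_image)
  qed
  ultimately show ?thesis by metis
qed

definition monochromatic_sets :: "(nat \<Rightarrow> nat) \<Rightarrow> nat \<Rightarrow> nat \<Rightarrow> nat set set" where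
  "monochromatic_sets \<beta> r k = {I. I \<subseteq> {..<r} \<and> card I = k \<and> monochromatic \<beta> I}"

text \<open>For generic coloured rows the singular square blocks are those with all \<open>k\<close> columns and \<open>k\<close> rows
  of one colour.\<close>

lemma ex_card_regular_pairs_monochromatic:
  assumes "k \<ge> 2"
  shows "\<exists>m :: nat \<Rightarrow> nat \<Rightarrow> complex.
    card (regular_pairs m r k) + card (monochromatic_sets \<beta> r k) = (r + k) choose k"
proof -
  obtain n where k: "k = Suc n" and n: "n \<ge> 1" using assms by (cases k) auto
  obtain m :: "nat \<Rightarrow> nat \<Rightarrow> complex" where
    hyper: "\<And>i. i < r \<Longrightarrow> m i n = of_nat (Suc (\<beta> i)) * (\<Sum>j<n. m i j)"
    and tk: "\<And>I J. I \<subseteq> {..<r} \<Longrightarrow> J \<subseteq> {..<Suc n} \<Longrightarrow> card I = card J \<Longrightarrow>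
       \<not> (J = {..<Suc n} \<and> monochromatic \<beta> I) \<Longrightarrow> trivial_kernel m I J"
    using generic_coloured_rows[OF n, of r \<beta>] by blast
  have singular: "\<not> trivial_kernel m I {..<Suc n}"
    if I: "I \<subseteq> {..<r}" and mono: "monochromatic \<beta> I" for I
  proof
    assume tkI: "trivial_kernel m I {..<Suc n}"
    obtain c where c: "\<And>i. i \<in> I \<Longrightarrow> \<beta> i = c" using mono by (auto simp: monochromatic_def)
    \<comment> \<open>The normal vector of the hyperplane of colour \<open>c\<close>.\<close>
    define x where "x j = (if j < n then of_nat (Suc c) else - 1 :: complex)" for j
    have "\<forall>i\<in>I. (\<Sum>j<Suc n. m i j * x j) = 0"
    proof
      fix i assume i: "i \<in> I"
      have "(\<Sum>j<Suc n. m i j * x j) = of_nat (Suc c) * (\<Sum>j<n. m i j) - m i n"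
        by (simp add: x_def sum_distrib_left mult.commute)
      then show "(\<Sum>j<Suc n. m i j * x j) = 0" using hyper[of i] c[OF i] i I by auto
    qed
    then have "x n = 0" using tkI by (auto simp: trivial_kernel_def)
    then show False by (simp add: x_def)
  qed
  define D where "D = (\<lambda>I. (I, {..<k})) ` monochromatic_sets \<beta> r k"
  have D: "D \<subseteq> balanced_pairs r k"
    by (auto simp: D_def monochromatic_sets_def balanced_pairs_def)
  have "trivial_kernel m I J \<longleftrightarrow> (I, J) \<notin> D" if IJ: "(I, J) \<in> balanced_pairs r k" for I J
  proof -
    have sub: "I \<subseteq> {..<r}" "J \<subseteq> {..<Suc n}" "card I = card J"
      using IJ by (auto simp: balanced_pairs_def k)
    have "(I, J) \<in> D \<longleftrightarrow> J = {..<Suc n} \<and> monochromatic \<beta> I"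
      using sub by (auto simp: D_def monochromatic_sets_def k)
    then show ?thesis using tk[OF sub] singular[OF sub(1)] by blast
  qed
  then have "regular_pairs m r k = balanced_pairs r k - D"
    by (auto simp: regular_pairs_def)
  then have "card (regular_pairs m r k) + card D = card (balanced_pairs r k)"
    using card_Diff_subset[OF finite_subset[OF D finite_balanced_pairs] D]
      card_mono[OF finite_balanced_pairs D] by simp
  moreover have "card D = card (monochromatic_sets \<beta> r k)"
    unfolding D_def by (rule card_image) (simp add: inj_on_def)
  ultimately show ?thesis using card_balanced_pairs by metis
qed

section \<open>Counting monochromatic sets\<close>

definition mono_count_attained :: "nat \<Rightarrow> nat \<Rightarrow> nat \<Rightarrow> bool" where
  "mono_count_attained k h r \<longleftrightarrow> (\<exists>\<beta>. card (monochromatic_sets \<beta> r k) = h)"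

lemma mono_count_attained_zero: "k \<ge> 1 \<Longrightarrow> mono_count_attained k 0 0"
  by (auto simp: mono_count_attained_def monochromatic_sets_def)

text \<open>The \<open>a\<close> new points form a colour class of their own. The old colours are shifted by one, which
  leaves the colour 0 free for it.\<close>

lemma mono_count_attained_add:
  assumes "k \<ge> 1" "mono_count_attained k h r"
  shows "mono_count_attained k (h + (a choose k)) (r + a)"
proof -
  obtain \<beta> where \<beta>: "card (monochromatic_sets \<beta> r k) = h"
    using assms(2) by (auto simp: mono_count_attained_def)
  define \<beta>' where "\<beta>' i = (if i < r then Suc (\<beta> i) else 0)" for i
  let ?A = "monochromatic_sets \<beta> r k" and ?B = "{I. I \<subseteq> {r..<r + a} \<and> card I = k}"
  have "monochromatic_sets \<beta>' (r + a) k = ?A \<union> ?B"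
  proof (intro equalityI subsetI)
    fix I assume "I \<in> monochromatic_sets \<beta>' (r + a) k"
    then obtain c where I: "I \<subseteq> {..<r + a}" "card I = k" and c: "\<And>i. i \<in> I \<Longrightarrow> \<beta>' i = c"
      by (auto simp: monochromatic_sets_def monochromatic_def)
    show "I \<in> ?A \<union> ?B"
    proof (cases c)
      case 0
      then have "i \<ge> r" if "i \<in> I" for i using c[OF that] by (auto simp: \<beta>'_def split: if_splits)
      then have "I \<in> ?B" using I by fastforce
      then show ?thesis ..
    next
      case (Suc d)
      then have "i < r \<and> \<beta> i = d" if "i \<in> I" for i
        using c[OF that] by (auto simp: \<beta>'_def split: if_splits)
      then have "I \<in> ?A" using I by (auto simp: monochromatic_sets_def monochromatic_def)
      then show ?thesis ..
    qed
  next
    fix I assume "I \<in> ?A \<union> ?B"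
    then show "I \<in> monochromatic_sets \<beta>' (r + a) k"
    proof
      assume "I \<in> ?A"
      then obtain c where I: "I \<subseteq> {..<r}" "card I = k" and c: "\<And>i. i \<in> I \<Longrightarrow> \<beta> i = c"
        by (auto simp: monochromatic_sets_def monochromatic_def)
      have "\<beta>' i = Suc c" if "i \<in> I" for i using c[OF that] that I(1) by (auto simp: \<beta>'_def)
      then show ?thesis using I by (auto simp: monochromatic_sets_def monochromatic_def)
    next
      assume I: "I \<in> ?B"
      then have "\<beta>' i = 0" if "i \<in> I" for i using that by (auto simp: \<beta>'_def)
      then show ?thesis using I by (auto simp: monochromatic_sets_def monochromatic_def)
    qed
  qed
  moreover have "?A \<inter> ?B = {}"
  proof (rule equals0I)
    fix I assume "I \<in> ?A \<inter> ?B"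
    then have I: "I \<subseteq> {..<r}" "I \<subseteq> {r..<r + a}" "card I = k"
      by (auto simp: monochromatic_sets_def)
    have "I \<noteq> {}" using I(3) assms(1) by auto
    then obtain i where "i \<in> I" by blast
    then show False using I(1,2) by fastforce
  qed
  moreover have "finite ?A"
    by (rule finite_subset[of _ "Pow {..<r}"]) (auto simp: monochromatic_sets_def)
  moreover have "finite ?B" by (rule finite_subset[of _ "Pow {r..<r + a}"]) auto
  moreover have "card ?B = a choose k" using n_subsets[of "{r..<r + a}" k] by simp
  ultimately have "card (monochromatic_sets \<beta>' (r + a) k) = h + (a choose k)"
    using \<beta> by (simp add: card_Un_disjoint)
  then show ?thesis unfolding mono_count_attained_def by blast
qed

lemma mono_count_attained_mono:
  assumes "k \<ge> 2" "mono_count_attained k h s" "s \<le> r"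
  shows "mono_count_attained k h r"
  using assms(3)
proof (induction r rule: dec_induct)
  case base
  show ?case by (rule assms(2))
next
  case (step n)
  have "1 choose k = 0" by (rule binomial_eq_0) (use assms(1) in simp)
  moreover have "mono_count_attained k (h + (1 choose k)) (n + 1)"
    by (rule mono_count_attained_add) (use assms(1) step.IH in simp_all)
  ultimately show ?case by (simp only: add_0_right Suc_eq_plus1)
qed

lemma mono_count_attained_mult:
  assumes "k \<ge> 1"
  shows "mono_count_attained k h (h * k)"
proof (induction h)
  case 0
  show ?case using mono_count_attained_zero[OF assms] by simp
next
  case (Suc h)
  then show ?case using mono_count_attained_add[OF assms, of h "h * k" k] by (simp add: add.commute)
qed

text \<open>The left side has order \<open>n ^ (k - 1)\<close> and the right side order \<open>n ^ k\<close>. Explicitly, the left side is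
  at most \<open>(2 * n) ^ (k - 1)\<close> and the right side at least \<open>(n / (8 * k)) ^ k\<close>.\<close>

lemma choose_pred_le_choose_quarter:
  assumes "k \<ge> 1"
  shows "\<exists>T\<ge>1. \<forall>n\<ge>T. (n + k) choose (k - 1) \<le> (n div 4) choose k"
proof -
  define T where "T = 8 * k + 2 ^ (k - 1) * (8 * k) ^ k"
  have "(n + k) choose (k - 1) \<le> (n div 4) choose k" if n: "n \<ge> T" for n
  proof -
    have n8: "8 * k \<le> n" using n by (simp add: T_def)
    then have k4: "k \<le> n div 4" and n4: "n \<le> 8 * (n div 4)" using assms by linarith+
    have "(n + k) choose (k - 1) \<le> (n + k) ^ (k - 1)" by (rule binomial_le_pow) simp
    also have "\<dots> \<le> (2 * n) ^ (k - 1)" using n8 by (intro power_mono) auto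
    finally have "((n + k) choose (k - 1)) * (8 * k) ^ k \<le> (2 * n) ^ (k - 1) * (8 * k) ^ k" by simp
    also have "\<dots> = n ^ (k - 1) * (2 ^ (k - 1) * (8 * k) ^ k)" by (simp add: power_mult_distrib)
    also have "\<dots> \<le> n ^ (k - 1) * n" using n by (simp add: T_def)
    also have "\<dots> = n ^ k" using assms by (metis mult.commute power_eq_if not_one_le_zero)
    also have "\<dots> \<le> (8 * (n div 4)) ^ k" by (rule power_mono[OF n4]) simp
    finally have "real (((n + k) choose (k - 1)) * (8 * k) ^ k) \<le> real ((8 * (n div 4)) ^ k)"
      by (rule of_nat_mono)
    also have "\<dots> = (real (n div 4) / real k) ^ k * real ((8 * k) ^ k)"
      using assms by (simp add: power_mult_distrib power_divide)
    also have "\<dots> \<le> real ((n div 4) choose k) * real ((8 * k) ^ k)"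
      by (intro mult_right_mono binomial_ge_n_over_k_pow_k k4) simp
    finally have "((n + k) choose (k - 1)) * (8 * k) ^ k \<le> ((n div 4) choose k) * (8 * k) ^ k"
      by (metis of_nat_le_iff of_nat_mult)
    then show ?thesis using assms by simp
  qed
  moreover have "T \<ge> 1" using assms by (simp add: T_def)
  ultimately show ?thesis by blast
qed

text \<open>Greedy choice of colour classes. If \<open>t\<close> is the largest size with \<open>t choose k \<le> h\<close>, the rest of \<open>h\<close>
  is below \<open>t choose (k - 1)\<close>, hence below \<open>(a div 4) choose k\<close> when \<open>a\<close> is large. By induction
  the rest needs \<open>2 * (a div 4) + D\<close> points, and together with the \<open>t < a\<close> points of the class that is
  at most \<open>2 * a + D\<close>. The constant \<open>D\<close> pays for small \<open>a\<close>, where classes of size \<open>k\<close>, which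
  contribute 1 each, suffice.\<close>

lemma mono_count_attained_below_choose:
  assumes "k \<ge> 2"
  shows "\<exists>D. \<forall>a h. h < a choose k \<longrightarrow> mono_count_attained k h (2 * a + D)"
proof -
  have k1: "k \<ge> 1" using assms by simp
  obtain T where T: "T \<ge> 1" "\<And>n. n \<ge> T \<Longrightarrow> (n + k) choose (k - 1) \<le> (n div 4) choose k"
    using choose_pred_le_choose_quarter[OF k1] by blast
  define D where "D = (T choose k) * k"
  have "mono_count_attained k h (2 * a + D)" if "h < a choose k" for a h
    using that
  proof (induction a arbitrary: h rule: less_induct)
    case (less a)
    show ?case
    proof (cases "a < T")
      case True
      then have "a choose k \<le> T choose k" by (intro binomial_right_mono) simp
      then have "h * k \<le> D" unfolding D_def using less.prems by (intro mult_right_mono) auto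
      then show ?thesis using mono_count_attained_mono[OF assms mono_count_attained_mult[OF k1]] by simp
    next
      case False
      define l where "l = (LEAST x. h < x choose k)"
      have l: "h < l choose k" "l \<le> a"
        unfolding l_def using less.prems by (auto intro: LeastI Least_le)
      have "l \<noteq> 0" using l(1) k1 binomial_eq_0[of 0 k] by (intro notI) simp
      then obtain t where t: "l = Suc t" by (cases l) auto
      have "t choose k \<le> h"
        using not_less_Least[of t "\<lambda>x. h < x choose k"] t unfolding l_def by simp
      have "l choose k = (t choose (k - 1)) + (t choose k)"
        using k1 t by (cases k) auto
      then have "h - (t choose k) < t choose (k - 1)" using l(1) \<open>t choose k \<le> h\<close> by linarith
      also have "\<dots> \<le> (a + k) choose (k - 1)" using l(2) t by (intro binomial_right_mono) simp
      also have "\<dots> \<le> (a div 4) choose k" using T(2) False by simp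
      finally have "mono_count_attained k (h - (t choose k)) (2 * (a div 4) + D)"
        using less.IH[of "a div 4"] T(1) False by simp
      from mono_count_attained_add[OF k1 this, of t]
      have "mono_count_attained k h (2 * (a div 4) + D + t)" using \<open>t choose k \<le> h\<close> by simp
      then show ?thesis by (rule mono_count_attained_mono[OF assms]) (use l(2) t in linarith)
    qed
  qed
  then show ?thesis by blast
qed

lemma mono_count_attained_below_choose_pred:
  assumes "k \<ge> 2"
  shows "\<exists>R. \<forall>r\<ge>R. \<forall>h. h < (r + k) choose (k - 1) \<longrightarrow> mono_count_attained k h r"
proof -
  obtain D where D: "\<And>a h. h < a choose k \<Longrightarrow> mono_count_attained k h (2 * a + D)"
    using mono_count_attained_below_choose[OF assms] by blast
  obtain T where T: "\<And>n. n \<ge> T \<Longrightarrow> (n + k) choose (k - 1) \<le> (n div 4) choose k"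
    using choose_pred_le_choose_quarter[of k] assms by auto
  have "mono_count_attained k h r" if "r \<ge> T + 2 * D" "h < (r + k) choose (k - 1)" for r h
  proof -
    have "h < (r div 4) choose k" using T[of r] that by simp
    then have "mono_count_attained k h (2 * (r div 4) + D)" by (rule D)
    then show ?thesis by (rule mono_count_attained_mono[OF assms]) (use that(1) in linarith)
  qed
  then show ?thesis by blast
qed

section \<open>All values of the number of invertible submatrices\<close>

text \<open>Take the least number \<open>s\<close> of rows for which \<open>b \<le> (s + k) choose k\<close>. By Pascal's rule the deficit
  \<open>((s + k) choose k) - b\<close> is below \<open>(s + k - 1) choose (k - 1)\<close>, so for large \<open>s\<close> it is a number of
  monochromatic sets, and the remaining rows are zero. For small \<open>s\<close> the value \<open>b\<close> is bounded
  independently of \<open>r\<close>, and one nonzero column suffices as soon as \<open>r\<close> is at least that bound.\<close>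

lemma ex_card_regular_pairs:
  assumes "k \<ge> 2"
  shows "\<exists>R. \<forall>r\<ge>R. \<forall>b. 1 \<le> b \<and> b \<le> (r + k) choose k \<longrightarrow>
    (\<exists>m :: nat \<Rightarrow> nat \<Rightarrow> complex. card (regular_pairs m r k) = b)"
proof -
  obtain R where R: "\<And>r h. r \<ge> R \<Longrightarrow> h < (r + k) choose (k - 1) \<Longrightarrow> mono_count_attained k h r"
    using mono_count_attained_below_choose_pred[OF assms] by blast
  have "\<exists>m :: nat \<Rightarrow> nat \<Rightarrow> complex. card (regular_pairs m r k) = b"
    if r: "r \<ge> (R + k) choose k" and b: "1 \<le> b" "b \<le> (r + k) choose k" for r b
  proof (cases "b \<le> Suc r")
    case True
    then show ?thesis using ex_card_regular_pairs_le_Suc[OF b(1)] assms by simp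
  next
    case False
    define s where "s = (LEAST s. b \<le> (s + k) choose k)"
    have s: "b \<le> (s + k) choose k" "s \<le> r"
      unfolding s_def using b(2) by (auto intro: LeastI Least_le)
    have "\<not> s \<le> R"
    proof
      assume "s \<le> R"
      then have "(s + k) choose k \<le> (R + k) choose k" by (intro binomial_right_mono) simp
      then show False using s(1) r False by linarith
    qed
    then obtain t where t: "s = Suc t" by (cases s) auto
    have "(t + k) choose k < b"
      using not_less_Least[of t "\<lambda>s. b \<le> (s + k) choose k"] t unfolding s_def by simp
    moreover have "(s + k) choose k = ((t + k) choose (k - 1)) + ((t + k) choose k)"
      using assms t by (cases k) auto
    moreover have "(t + k) choose (k - 1) \<le> (s + k) choose (k - 1)"
      using t by (intro binomial_right_mono) simp
    ultimately have "((s + k) choose k) - b < (s + k) choose (k - 1)" using s(1) by linarith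
    then have "mono_count_attained k (((s + k) choose k) - b) s" using R \<open>\<not> s \<le> R\<close> by simp
    then obtain \<beta> where \<beta>: "card (monochromatic_sets \<beta> s k) = ((s + k) choose k) - b"
      by (auto simp: mono_count_attained_def)
    obtain m :: "nat \<Rightarrow> nat \<Rightarrow> complex" where
      "card (regular_pairs m s k) + card (monochromatic_sets \<beta> s k) = (s + k) choose k"
      using ex_card_regular_pairs_monochromatic[OF assms] by blast
    then have "card (regular_pairs m s k) = b" using \<beta> s(1) by linarith
    then show ?thesis using regular_pairs_pad_zero_rows[OF s(2), of m k] by metis
  qed
  then show ?thesis by blast
qed

theorem theorem1p8:
  fixes k :: nat
  assumes "k \<ge> 3"
  shows "\<exists>R::nat. R \<ge> 1 \<and>
           (\<forall>r\<ge>R. \<forall>b::nat. 1 \<le> b \<and> b \<le> (r + k) choose k \<longrightarrow>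
              (\<exists>M. rkb_star_matrix r k b M) \<and> (\<exists>N. nrb_matrix (r + k) r b N))"
proof -
  obtain R where R: "\<And>r b. r \<ge> R \<Longrightarrow> 1 \<le> b \<Longrightarrow> b \<le> (r + k) choose k \<Longrightarrow>
      \<exists>m :: nat \<Rightarrow> nat \<Rightarrow> complex. card (regular_pairs m r k) = b"
    using ex_card_regular_pairs[of k] assms by auto
  show ?thesis
  proof (intro exI[of _ "max 1 R"] conjI allI impI)
    fix r b assume "max 1 R \<le> r" and "1 \<le> b \<and> b \<le> (r + k) choose k"
    then obtain m :: "nat \<Rightarrow> nat \<Rightarrow> complex" where "card (regular_pairs m r k) = b"
      using R by auto
    then show "\<exists>M. rkb_star_matrix r k b M" "\<exists>N. nrb_matrix (r + k) r b N"
      using rkb_star_matrix_of_regular_pairs nrb_matrix_of_regular_pairs by blast+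
  qed simp
qed

end
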